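(* Let $\varphi$ be an injective self-map of the tree $T$ with no periodic points and suppose the operator $C_\varphi$ is bounded on $\mathcal{L}_0$. If there exists a strictly increasing sequence of nonnegative integers $(n_k)_{k\in\mathbb{N}}$ such that for every cofinite set $S\subseteq T$ there exists $N\in\mathbb{N}$ such that $\varphi^{n_k}(S)\subseteq S$ for every $k\ge N$, then $\lambda C_\varphi$ is hypercyclic on $\mathcal{L}_0$ for each $\lambda\in\mathbb{C}$ with $|\lambda|>1$.
   Context: $T$ is an infinite, locally finite tree (connected graph without cycles, identified with its vertex set) with a chosen root $o$, in which every vertex except possibly $o$ has degree greater than $1$. $d(v,w)$ is the number of edges of the unique path joining $v$ and $w$, and $|v|=d(o,v)$. $T^*=T\setminus\{o\}$. For $v\in T^*$, the parent $v^-$ is the neighbor of $v$ on the path from $o$ to $v$. The Lipschitz space $\mathcal{L}$ is the set of $f:T\to\mathbb{C}$ with $\sup_{v\in T^*}|f(v)-f(v^-)|<\infty$, a Banach space under $\|f\|_{\mathcal{L}}=\max\{|f(o)|,\sup_{v\in T^*}|f(v)-f(v^-)|\}$. The little Lipschitz space $\mathcal{L}_0$ is the closed subspace of $f\in\mathcal{L}$ with $\lim_{|v|\to\infty}|f(v)-f(v^-)|=0$. The composition operator is $C_\varphi f=f\circ\varphi$; it is bounded on $\mathcal{L}_0$ if it maps $\mathcal{L}_0$ into itself and is a bounded operator there. A bounded operator $A$ on a Banach space is hypercyclic if there is a vector $f$ whose orbit $\{A^nf:n\ge 0\}$ is dense. $\varphi^n$ is the $n$-fold iterate of $\varphi$;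 a periodic point of $\varphi$ is a vertex $v$ with $\varphi^p(v)=v$ for some integer $p\ge1$. A set $S\subseteq T$ is cofinite if $T\setminus S$ is finite. *)

theory Defs
  imports "HOL-Analysis.Analysis"
begin

section \<open>Rooted trees\<close>

text \<open>
  A graph is given by its adjacency relation \<open>E\<close>; its vertex set is the whole type \<open>'a\<close>.
\<close>

definition graph_path :: "('a \<Rightarrow> 'a \<Rightarrow> bool) \<Rightarrow> 'a \<Rightarrow> 'a list \<Rightarrow> 'a \<Rightarrow> bool" where
  "graph_path E u p v \<longleftrightarrow>
     p \<noteq> [] \<and> hd p = u \<and> last p = v \<and> distinct p \<and> successively E p"

definition graph_cycle :: "('a \<Rightarrow> 'a \<Rightarrow> bool) \<Rightarrow> 'a list \<Rightarrow> bool" where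
  "graph_cycle E p \<longleftrightarrow>
     length p \<ge> 3 \<and> distinct p \<and> successively E p \<and> E (last p) (hd p)"

locale rooted_tree =
  fixes E :: "'a \<Rightarrow> 'a \<Rightarrow> bool" and r :: 'a
  assumes adj_sym: "E u v \<Longrightarrow> E v u"
    and adj_irrefl: "\<not> E v v"
    and connected: "\<exists>p. graph_path E u p v"
    and acyclic: "\<not> graph_cycle E p"
    and infinite_vertices: "infinite (UNIV :: 'a set)"
    and locally_finite: "finite {w. E v w}"
    and degree_gt_1: "v \<noteq> r \<Longrightarrow> card {w. E v w} > 1"

definition the_path :: "('a \<Rightarrow> 'a \<Rightarrow> bool) \<Rightarrow> 'a \<Rightarrow> 'a \<Rightarrow> 'a list" where
  "the_path E u v = (THE p. graph_path E u p v)"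

text \<open>A path with \<open>k\<close> vertices has \<open>k - 1\<close> edges.\<close>

definition tree_dist :: "('a \<Rightarrow> 'a \<Rightarrow> bool) \<Rightarrow> 'a \<Rightarrow> 'a \<Rightarrow> nat" where
  "tree_dist E u v = length (the_path E u v) - 1"

text \<open>Only meaningful for \<open>v \<noteq> r\<close>.\<close>

definition parent :: "('a \<Rightarrow> 'a \<Rightarrow> bool) \<Rightarrow> 'a \<Rightarrow> 'a \<Rightarrow> 'a" where
  "parent E r v = (THE w. E v w \<and> w \<in> set (the_path E r v))"

section \<open>Lipschitz spaces\<close>

definition lipschitz_space :: "('a \<Rightarrow> 'a \<Rightarrow> bool) \<Rightarrow> 'a \<Rightarrow> ('a \<Rightarrow> complex) set" where
  "lipschitz_space E r = {f. bdd_above ((\<lambda>v. cmod (f v - f (parent E r v))) ` (UNIV - {r}))}"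

definition lipschitz_norm :: "('a \<Rightarrow> 'a \<Rightarrow> bool) \<Rightarrow> 'a \<Rightarrow> ('a \<Rightarrow> complex) \<Rightarrow> real" where
  "lipschitz_norm E r f =
     max (cmod (f r)) (SUP v\<in>UNIV - {r}. cmod (f v - f (parent E r v)))"

text \<open>
  The filter \<open>filtercomap (tree_dist E r) at_top\<close> expresses \<open>|v| \<rightarrow> \<infinity>\<close>; it ignores the root, where
  the parent is unspecified.
\<close>

definition little_lipschitz_space :: "('a \<Rightarrow> 'a \<Rightarrow> bool) \<Rightarrow> 'a \<Rightarrow> ('a \<Rightarrow> complex) set" where
  "little_lipschitz_space E r =
     {f \<in> lipschitz_space E r.
        ((\<lambda>v. cmod (f v - f (parent E r v))) \<longlongrightarrow> 0) (filtercomap (tree_dist E r) at_top)}"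

section \<open>Operators on normed spaces of functions\<close>

text \<open>
  A normed space is given by a set \<open>X\<close> of complex-valued functions with pointwise operations
  and a norm \<open>N\<close> that is meaningful on \<open>X\<close>.
\<close>

definition bounded_operator_on ::
  "('a \<Rightarrow> complex) set \<Rightarrow> (('a \<Rightarrow> complex) \<Rightarrow> real) \<Rightarrow> (('a \<Rightarrow> complex) \<Rightarrow> 'a \<Rightarrow> complex) \<Rightarrow> bool"
where
  "bounded_operator_on X N A \<longleftrightarrow>
     (\<forall>f\<in>X. A f \<in> X) \<and>
     (\<forall>f\<in>X. \<forall>g\<in>X. A (\<lambda>v. f v + g v) = (\<lambda>v. A f v + A g v)) \<and>
     (\<forall>c. \<forall>f\<in>X. A (\<lambda>v. c * f v) = (\<lambda>v. c * A f v)) \<and>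
     (\<exists>K. \<forall>f\<in>X. N (A f) \<le> K * N f)"

definition hypercyclic_on ::
  "('a \<Rightarrow> complex) set \<Rightarrow> (('a \<Rightarrow> complex) \<Rightarrow> real) \<Rightarrow> (('a \<Rightarrow> complex) \<Rightarrow> 'a \<Rightarrow> complex) \<Rightarrow> bool"
where
  "hypercyclic_on X N A \<longleftrightarrow>
     bounded_operator_on X N A \<and>
     (\<exists>f\<in>X. Metric_space.mtopology X (\<lambda>g h. N (\<lambda>v. g v - h v)) closure_of
               {(A ^^ n) f | n. True} = X)"

definition composition_operator :: "('a \<Rightarrow> 'a) \<Rightarrow> ('a \<Rightarrow> complex) \<Rightarrow> 'a \<Rightarrow> complex" where
  "composition_operator \<phi> f = f \<circ> \<phi>"

end

theory Submission
  imports Defs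
begin

text \<open>
  Since \<open>\<phi>\<close> has no periodic points, a vertex meets a finite set \<open>F\<close> only finitely often along its
  orbit; together with the hypothesis on \<open>n k\<close> this shows that the range of \<open>\<phi> ^^ n\<close> misses \<open>F\<close> for
  all large \<open>n\<close>. Hence \<open>A = c C\<^sub>\<phi>\<close> satisfies \<open>A\<^sup>n y = 0\<close> eventually for finitely supported \<open>y\<close>, and
  these are dense in the little Lipschitz space. Injectivity gives the right inverses
  \<open>y \<mapsto> c\<^sup>-\<^sup>n y \<circ> \<phi>\<^sup>-\<^sup>n\<close> (extended by zero), which contract the supremum norm by \<open>\<bar>c\<bar>\<^sup>-\<^sup>n\<close>.
  Pasting such preimages of a countable dense sequence \<open>y j\<close>, at widely spaced exponents so that their
  supports are disjoint, yields a function vanishing at infinity whose orbit comes arbitrarily close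
  to every \<open>y j\<close>. The estimates can be done in the supremum norm, which dominates half the
  Lipschitz norm.
\<close>

section \<open>Paths and levels in a rooted tree\<close>

context rooted_tree
begin

abbreviation level :: "'a \<Rightarrow> nat" where "level \<equiv> tree_dist E r"

abbreviation par :: "'a \<Rightarrow> 'a" where "par \<equiv> parent E r"

section \<open>Uniqueness of paths\<close>

lemma successively_converse_adj: "successively (\<lambda>x y. E y x) p \<longleftrightarrow> successively E p"
  using adj_sym by (metis (full_types) successively_mono)

text \<open>Paths that part after a common vertex meet again, as both end in \<open>v\<close>. Going
  out along one up to its first vertex on the other, and back along the other, closes a
  cycle.\<close>

lemma graph_path_unique:
  assumes "graph_path E u p v" "graph_path E u q v"
  shows "p = q"
  using assms
proof (induction p arbitrary: u q)
  case Nil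
  then show ?case by (simp add: graph_path_def)
next
  case (Cons a p')
  then have a: "a = u" by (simp add: graph_path_def)
  obtain q' where q: "q = u # q'"
    using Cons.prems(2) by (cases q) (auto simp: graph_path_def)
  show ?case
  proof (cases "p' = [] \<or> q' = []")
    case True
    then show ?thesis
      using Cons.prems a q by (auto simp: graph_path_def split: if_splits)
  next
    case False
    then have p'_path: "graph_path E (hd p') p' v" and q'_path: "graph_path E (hd q') q' v"
      using Cons.prems a q by (auto simp: graph_path_def successively_Cons)
    have u: "u \<notin> set p'" "u \<notin> set q'" "E u (hd p')" "E u (hd q')"
      using Cons.prems a q False by (auto simp: graph_path_def successively_Cons)
    show ?thesis
    proof (cases "hd p' = hd q'")
      case True
      then show ?thesis
        using Cons.IH[OF p'_path] q'_path a q by simp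
    next
      case neq: False
      have "\<exists>x\<in>set p'. x \<in> set q'"
        using p'_path q'_path False by (metis graph_path_def last_in_set)
      then obtain ys x zs where p': "p' = ys @ x # zs" "x \<in> set q'" "\<forall>y\<in>set ys. y \<notin> set q'"
        using split_list_first_prop[of p' "\<lambda>x. x \<in> set q'"] by blast
      then obtain ys2 zs2 where q': "q' = ys2 @ x # zs2"
        by (meson split_list)
      let ?c = "u # ys @ x # rev ys2"
      \<comment> \<open>Were both segments empty, both tails would start with \<open>x\<close>; so
        the closed walk has at least three vertices.\<close>
      have nonempty: "ys \<noteq> [] \<or> ys2 \<noteq> []"
        using neq p' q' by auto
      have "distinct ?c"
        using p'_path q'_path u p' q' by (auto simp: graph_path_def)
      moreover have "length ?c \<ge> 3"
        using nonempty by (cases ys; cases ys2) auto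
      moreover have "successively E ?c"
      proof -
        have s1: "successively E (ys @ [x])"
          using p'_path p' by (auto simp: graph_path_def successively_append_iff)
        have "successively E (ys2 @ [x])"
          using q'_path q' by (auto simp: graph_path_def successively_append_iff)
        then have "successively E (rev (ys2 @ [x]))"
          using successively_converse_adj by (simp only: successively_rev)
        then have "successively E (ys @ x # rev ys2)"
          using s1 by (auto simp: successively_append_iff)
        moreover have "hd (ys @ x # rev ys2) = hd p'"
          using p' by (cases ys) auto
        ultimately show ?thesis
          using u by (auto simp: successively_Cons)
      qed
      moreover have "E (last ?c) (hd ?c)"
      proof -
        have "last ?c = hd q'"
          using q' by (cases ys2) auto
        then show ?thesis using u adj_sym by auto
      qed
      ultimately have "graph_cycle E ?c"
        by (simp add: graph_cycle_def)
      then show ?thesis using acyclic by blast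
    qed
  qed
qed

lemma the_path_eq: "graph_path E u p v \<Longrightarrow> the_path E u v = p"
  unfolding the_path_def using graph_path_unique by blast

lemma graph_path_the_path: "graph_path E u (the_path E u v) v"
  using connected the_path_eq by metis

section \<open>Levels, parents and finiteness of balls\<close>

lemma level_root: "level r = 0"
proof -
  have "the_path E r r = [r]"
    by (rule the_path_eq) (simp add: graph_path_def)
  then show ?thesis by (simp add: tree_dist_def)
qed

text \<open>The parent is the last but one vertex of the path from the root: an earlier neighbour of
  \<open>v\<close> on that path would close a cycle with the rest of it. Dropping \<open>v\<close>
  leaves the path to the parent.\<close>

lemma parent_props:
  assumes "v \<noteq> r"
  shows adj_parent: "E v (par v)" and level_parent: "level v = Suc (level (par v))"
proof -
  let ?p = "the_path E r v"
  have p: "graph_path E r ?p v" by (rule graph_path_the_path)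
  obtain p0 where p0: "?p = p0 @ [v]"
    using p by (metis append_butlast_last_id graph_path_def)
  have ne: "p0 \<noteq> []"
    using p p0 assms by (auto simp: graph_path_def)
  define w where "w = last p0"
  have Ewv: "E v w"
    using p p0 ne adj_sym by (auto simp: graph_path_def successively_append_iff w_def)
  have "par v = w"
    unfolding parent_def
  proof (rule the_equality)
    show "E v w \<and> w \<in> set ?p"
      using Ewv ne p0 by (simp add: w_def)
  next
    fix x assume x: "E v x \<and> x \<in> set ?p"
    then have "x \<in> set p0"
      using p0 adj_irrefl by auto
    then obtain xs ys where xs: "p0 = xs @ x # ys"
      by (meson split_list)
    have "ys = []"
    proof (rule ccontr)
      assume "ys \<noteq> []"
      then have "graph_cycle E (x # ys @ [v])"
        using p p0 xs x by (auto simp: graph_cycle_def graph_path_def successively_append_iff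
            neq_Nil_conv)
      then show False using acyclic by blast
    qed
    then show "x = w" using xs by (simp add: w_def)
  qed
  moreover have "the_path E r w = p0"
    using p p0 ne
    by (intro the_path_eq) (auto simp: graph_path_def successively_append_iff w_def)
  ultimately show "E v (par v)" "level v = Suc (level (par v))"
    using Ewv p0 ne by (auto simp: tree_dist_def)
qed

lemma tree_induct [case_names root step]:
  assumes "P r" and "\<And>v. v \<noteq> r \<Longrightarrow> P (par v) \<Longrightarrow> P v"
  shows "P v"
proof (induction "level v" arbitrary: v rule: less_induct)
  case less
  then show ?case
    using assms level_parent[of v] by (cases "v = r") auto
qed

text \<open>By local finiteness: apart from the root, a vertex of the larger ball is a neighbour of
  its parent, which lies in the smaller ball.\<close>

lemma finite_level_le: "finite {v. level v \<le> n}"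
proof (induction n)
  case 0
  have "{v. level v \<le> 0} \<subseteq> {r}"
  proof
    fix v assume "v \<in> {v. level v \<le> 0}"
    then show "v \<in> {r}" using level_parent[of v] by auto
  qed
  then show ?case by (rule finite_subset) simp
next
  case (Suc n)
  have "{v. level v \<le> Suc n} \<subseteq> insert r (\<Union>w\<in>{v. level v \<le> n}. {u. E w u})"
  proof
    fix v assume "v \<in> {v. level v \<le> Suc n}"
    then have "level (par v) \<le> n" "E (par v) v" if "v \<noteq> r"
      using level_parent[OF that] adj_sym[OF adj_parent[OF that]] by auto
    then show "v \<in> insert r (\<Union>w\<in>{v. level v \<le> n}. {u. E w u})" by blast
  qed
  then show ?case
    by (rule finite_subset) (intro finite.insertI finite_UN_I Suc locally_finite)
qed

lemma countable_vertices: "countable (UNIV :: 'a set)"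
proof -
  have "countable (\<Union>n. {v. level v \<le> n})"
    using finite_level_le by (intro countable_UN countableI_type countable_finite)
  moreover have "(\<Union>n. {v. level v \<le> n}) = UNIV" by auto
  ultimately show ?thesis by simp
qed


section \<open>The little Lipschitz space\<close>

abbreviation \<L> :: "('a \<Rightarrow> complex) set" where "\<L> \<equiv> lipschitz_space E r"

abbreviation \<L>\<^sub>0 :: "('a \<Rightarrow> complex) set" where "\<L>\<^sub>0 \<equiv> little_lipschitz_space E r"

abbreviation lnorm :: "('a \<Rightarrow> complex) \<Rightarrow> real" where "lnorm \<equiv> lipschitz_norm E r"

lemma lipschitz_space_iff:
  "f \<in> \<L> \<longleftrightarrow> (\<exists>B. \<forall>v. v \<noteq> r \<longrightarrow> cmod (f v - f (par v)) \<le> B)"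
  by (auto simp: lipschitz_space_def bdd_above_def)

text \<open>Decay alone forces bounded increments, because only finitely many vertices lie below any
  given level; a sum over them serves as the bound.\<close>

lemma little_lipschitz_space_iff:
  "f \<in> \<L>\<^sub>0 \<longleftrightarrow> (\<forall>e>0. \<exists>n. \<forall>v. level v \<ge> n \<longrightarrow> cmod (f v - f (par v)) < e)"
proof
  assume "f \<in> \<L>\<^sub>0"
  then show "\<forall>e>0. \<exists>n. \<forall>v. level v \<ge> n \<longrightarrow> cmod (f v - f (par v)) < e"
    unfolding little_lipschitz_space_def
    by (simp add: tendsto_iff eventually_filtercomap_at_top_linorder)
next
  assume R: "\<forall>e>0. \<exists>n. \<forall>v. level v \<ge> n \<longrightarrow> cmod (f v - f (par v)) < e"
  then obtain n where n: "level v \<ge> n \<Longrightarrow> cmod (f v - f (par v)) < 1" for v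
    by (meson zero_less_one)
  define B where "B = (\<Sum>v\<in>{v. level v \<le> n}. cmod (f v - f (par v)))"
  have "cmod (f v - f (par v)) \<le> max 1 B" for v
  proof (cases "level v \<ge> n")
    case True
    then show ?thesis using n[of v] by simp
  next
    case False
    then have "cmod (f v - f (par v)) \<le> B"
      unfolding B_def by (intro member_le_sum) (auto simp: finite_level_le)
    then show ?thesis by simp
  qed
  then have "f \<in> \<L>" by (auto simp: lipschitz_space_iff)
  then show "f \<in> \<L>\<^sub>0"
    using R unfolding little_lipschitz_space_def
    by (simp add: tendsto_iff eventually_filtercomap_at_top_linorder)
qed

lemma little_subset: "f \<in> \<L>\<^sub>0 \<Longrightarrow> f \<in> \<L>"
  by (simp add: little_lipschitz_space_def)

lemma lipschitz_space_diff:
  assumes "f \<in> \<L>" "g \<in> \<L>"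
  shows "(\<lambda>v. f v - g v) \<in> \<L>"
proof -
  obtain A B where "\<And>v. v \<noteq> r \<Longrightarrow> cmod (f v - f (par v)) \<le> A"
    "\<And>v. v \<noteq> r \<Longrightarrow> cmod (g v - g (par v)) \<le> B"
    using assms by (auto simp: lipschitz_space_iff)
  then have "cmod ((f v - g v) - (f (par v) - g (par v))) \<le> A + B" if "v \<noteq> r" for v
    using that norm_triangle_le_diff[of "f v - f (par v)" "g v - g (par v)" "A + B"]
    by (force simp: algebra_simps)
  then show ?thesis by (auto simp: lipschitz_space_iff)
qed

lemma little_lipschitz_space_scale:
  assumes "f \<in> \<L>\<^sub>0"
  shows "(\<lambda>v. c * f v) \<in> \<L>\<^sub>0"
proof -
  have "\<exists>n. \<forall>v. level v \<ge> n \<longrightarrow> cmod (c * f v - c * f (par v)) < e" if "e > 0" for e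
  proof -
    have "e / (cmod c + 1) > 0" using that by (simp add: add_nonneg_pos)
    then obtain n where n: "\<forall>v. level v \<ge> n \<longrightarrow> cmod (f v - f (par v)) < e / (cmod c + 1)"
      using assms unfolding little_lipschitz_space_iff by meson
    have "cmod (c * f v - c * f (par v)) < e" if "level v \<ge> n" for v
    proof -
      have "cmod (c * f v - c * f (par v)) = cmod c * cmod (f v - f (par v))"
        by (metis norm_mult right_diff_distrib)
      also have "\<dots> \<le> (cmod c + 1) * cmod (f v - f (par v))"
        by (intro mult_right_mono) auto
      also have "\<dots> < e"
        using n that by (simp add: pos_less_divide_eq add_nonneg_pos mult.commute)
      finally show ?thesis .
    qed
    then show ?thesis by blast
  qed
  then show ?thesis by (simp add: little_lipschitz_space_iff)
qed

section \<open>The Lipschitz norm and its metric\<close>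

lemma lnorm_nonneg: "lnorm f \<ge> 0"
  by (simp add: lipschitz_norm_def max.coboundedI1)

lemma lnorm_root: "cmod (f r) \<le> lnorm f"
  by (simp add: lipschitz_norm_def)

lemma lnorm_step: "f \<in> \<L> \<Longrightarrow> v \<noteq> r \<Longrightarrow> cmod (f v - f (par v)) \<le> lnorm f"
  unfolding lipschitz_norm_def lipschitz_space_def
  by (rule max.coboundedI2, rule cSUP_upper) auto

lemma lnorm_le:
  assumes "cmod (f r) \<le> B" "\<And>v. v \<noteq> r \<Longrightarrow> cmod (f v - f (par v)) \<le> B"
  shows "lnorm f \<le> B"
proof -
  have "UNIV - {r} \<noteq> {}"
    using infinite_vertices by (metis finite.simps finite_insert infinite_remove)
  then show ?thesis
    unfolding lipschitz_norm_def using assms by (intro max.boundedI cSUP_least) auto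
qed

lemma lnorm_le_sup:
  assumes "\<And>v. cmod (f v) \<le> B"
  shows "lnorm f \<le> 2 * B"
proof (rule lnorm_le)
  show "cmod (f r) \<le> 2 * B"
    using assms[of r] norm_ge_zero[of "f r"] by linarith
  show "cmod (f v - f (par v)) \<le> 2 * B" for v
    using norm_triangle_ineq4[of "f v" "f (par v)"] assms[of v] assms[of "par v"] by linarith
qed

lemma lnorm_diff_commute: "lnorm (\<lambda>v. f v - g v) = lnorm (\<lambda>v. g v - f v)"
proof -
  have "f v - g v - (f u - g u) = - (g v - f v - (g u - f u))" for u v
    by simp
  then have "cmod (f v - g v - (f u - g u)) = cmod (g v - f v - (g u - f u))" for u v
    by (metis norm_minus_cancel)
  then show ?thesis
    by (simp add: lipschitz_norm_def norm_minus_commute)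
qed

lemma lnorm_triangle:
  assumes "f \<in> \<L>" "g \<in> \<L>" "h \<in> \<L>"
  shows "lnorm (\<lambda>v. f v - h v) \<le> lnorm (\<lambda>v. f v - g v) + lnorm (\<lambda>v. g v - h v)"
proof (rule lnorm_le)
  show "cmod (f r - h r) \<le> lnorm (\<lambda>v. f v - g v) + lnorm (\<lambda>v. g v - h v)"
    using norm_triangle_ineq[of "f r - g r" "g r - h r"]
      lnorm_root[of "\<lambda>v. f v - g v"] lnorm_root[of "\<lambda>v. g v - h v"] by simp
next
  fix v assume "v \<noteq> r"
  have eq: "f v - h v - (f (par v) - h (par v)) =
      (f v - g v - (f (par v) - g (par v))) + (g v - h v - (g (par v) - h (par v)))"
    by simp
  show "cmod (f v - h v - (f (par v) - h (par v)))
      \<le> lnorm (\<lambda>v. f v - g v) + lnorm (\<lambda>v. g v - h v)"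
    unfolding eq using \<open>v \<noteq> r\<close>
    by (intro norm_triangle_le add_mono
        lnorm_step[OF lipschitz_space_diff[OF assms(1,2)]]
        lnorm_step[OF lipschitz_space_diff[OF assms(2,3)]])
qed

lemma lnorm_scale_le:
  assumes "f \<in> \<L>"
  shows "lnorm (\<lambda>v. c * f v) \<le> cmod c * lnorm f"
proof (rule lnorm_le)
  show "cmod (c * f r) \<le> cmod c * lnorm f"
    by (simp add: norm_mult lnorm_root mult_left_mono)
next
  fix v assume "v \<noteq> r"
  then have "cmod c * cmod (f v - f (par v)) \<le> cmod c * lnorm f"
    using assms by (simp add: lnorm_step mult_left_mono)
  then show "cmod (c * f v - c * f (par v)) \<le> cmod c * lnorm f"
    by (metis norm_mult right_diff_distrib)
qed

text \<open>Norm zero gives equality at the root and equal increments; equality then spreads from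
  parents to children.\<close>

lemma lnorm_diff_eq_0_iff:
  assumes "f \<in> \<L>" "g \<in> \<L>"
  shows "lnorm (\<lambda>v. f v - g v) = 0 \<longleftrightarrow> f = g"
proof
  assume z: "lnorm (\<lambda>v. f v - g v) = 0"
  have "f v = g v" for v
  proof (induction v rule: tree_induct)
    case root
    then show ?case using lnorm_root[of "\<lambda>v. f v - g v"] z by simp
  next
    case (step v)
    then show ?case
      using lnorm_step[OF lipschitz_space_diff[OF assms], of v] z by simp
  qed
  then show "f = g" by blast
next
  assume "f = g"
  then show "lnorm (\<lambda>v. f v - g v) = 0"
    using lnorm_le[of "\<lambda>v. f v - g v" 0] lnorm_nonneg[of "\<lambda>v. f v - g v"] by simp
qed

lemma Metric_space_little: "Metric_space \<L>\<^sub>0 (\<lambda>f g. lnorm (\<lambda>v. f v - g v))"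
proof
  show "0 \<le> lnorm (\<lambda>v. f v - g v)" for f g by (rule lnorm_nonneg)
  show "lnorm (\<lambda>v. f v - g v) = lnorm (\<lambda>v. g v - f v)" for f g by (rule lnorm_diff_commute)
  show "lnorm (\<lambda>v. f v - g v) = 0 \<longleftrightarrow> f = g" if "f \<in> \<L>\<^sub>0" "g \<in> \<L>\<^sub>0" for f g
    using that by (intro lnorm_diff_eq_0_iff little_subset)
  show "lnorm (\<lambda>v. f v - h v) \<le> lnorm (\<lambda>v. f v - g v) + lnorm (\<lambda>v. g v - h v)"
    if "f \<in> \<L>\<^sub>0" "g \<in> \<L>\<^sub>0" "h \<in> \<L>\<^sub>0" for f g h
    using that by (intro lnorm_triangle little_subset)
qed

section \<open>Functions vanishing at infinity, and density of finite support\<close>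

lemma vanishing_imp_little:
  assumes "\<And>e. e > 0 \<Longrightarrow> finite {v. cmod (f v) \<ge> e}"
  shows "f \<in> \<L>\<^sub>0"
  unfolding little_lipschitz_space_iff
proof (intro allI impI)
  fix e :: real assume "e > 0"
  then have "finite (level ` {v. cmod (f v) \<ge> e / 2})"
    by (intro finite_imageI assms) simp
  then obtain n where n: "\<And>v. cmod (f v) \<ge> e / 2 \<Longrightarrow> level v < n"
    unfolding finite_nat_set_iff_bounded by auto
  \<comment> \<open>One extra level excludes the root and keeps the parent at level at least
    \<open>n\<close> too, so both values are below \<open>e / 2\<close>.\<close>
  have "cmod (f v - f (par v)) < e" if "level v \<ge> Suc n" for v
  proof -
    have "v \<noteq> r" using that level_root by auto
    then have "level (par v) \<ge> n" using level_parent[of v] that by simp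
    then have "cmod (f v) < e / 2" "cmod (f (par v)) < e / 2"
      using n[of v] n[of "par v"] that by force+
    then show ?thesis
      using norm_triangle_ineq4[of "f v" "f (par v)"] by linarith
  qed
  then show "\<exists>n. \<forall>v. level v \<ge> n \<longrightarrow> cmod (f v - f (par v)) < e" by blast
qed

lemma finite_support_imp_little:
  assumes "finite {v. f v \<noteq> 0}"
  shows "f \<in> \<L>\<^sub>0"
proof (rule vanishing_imp_little)
  fix e :: real assume "e > 0"
  then have "{v. cmod (f v) \<ge> e} \<subseteq> {v. f v \<noteq> 0}" by auto
  then show "finite {v. cmod (f v) \<ge> e}" using assms finite_subset by blast
qed

text \<open>Beyond some level each step away from the root adds less than \<open>d\<close>; the
  finitely many values up to that level are absorbed into \<open>C\<close>.\<close>

lemma little_sublinear_growth: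
  fixes d :: real
  assumes "h \<in> \<L>\<^sub>0" "d > 0"
  obtains C where "C \<ge> 0" "\<And>v. cmod (h v) \<le> C + d * level v"
proof -
  obtain n where n: "\<And>v. level v \<ge> n \<Longrightarrow> cmod (h v - h (par v)) < d"
    using assms unfolding little_lipschitz_space_iff by meson
  define C where "C = (\<Sum>v\<in>{v. level v \<le> n}. cmod (h v))"
  have small: "cmod (h v) \<le> C + d * level v" if "level v \<le> n" for v
  proof -
    have "cmod (h v) \<le> C"
      unfolding C_def using that by (intro member_le_sum) (auto simp: finite_level_le)
    then show ?thesis using assms(2) by (simp add: add_increasing2)
  qed
  have "cmod (h v) \<le> C + d * level v" for v
  proof (induction v rule: tree_induct)
    case root
    then show ?case using small[of r] level_root by simp
  next
    case (step v)
    show ?case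
    proof (cases "level v \<le> n")
      case True
      then show ?thesis by (rule small)
    next
      case False
      then have "cmod (h v - h (par v)) < d" using n by simp
      moreover have "real (level v) = level (par v) + 1" using level_parent step by simp
      ultimately show ?thesis
        using step norm_triangle_ineq2[of "h v" "h (par v)"] by (simp add: algebra_simps)
    qed
  qed
  moreover have "C \<ge> 0" by (simp add: C_def sum_nonneg)
  ultimately show thesis using that by blast
qed

text \<open>
  A function of the little Lipschitz space is \<open>o(\<bar>v\<bar>)\<close>, so cutting it off linearly between
  the levels \<open>n\<close> and \<open>2n\<close> changes the increments only by a small amount.
\<close>

lemma finite_support_dense:
  assumes h: "h \<in> \<L>\<^sub>0" and e: "e > 0"
  obtains g where "finite {v. g v \<noteq> 0}" "lnorm (\<lambda>v. h v - g v) < e"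
proof -
  \<comment> \<open>The cutoff will cost at most \<open>4 * d\<close>, which stays strictly below
    \<open>e\<close>.\<close>
  define d where "d = e / 5"
  have d: "d > 0" using e by (simp add: d_def)
  obtain C where C: "C \<ge> 0" "\<And>v. cmod (h v) \<le> C + d * level v"
    using little_sublinear_growth[OF h d] by blast
  obtain n0 where n0: "\<And>v. level v \<ge> n0 \<Longrightarrow> cmod (h v - h (par v)) < d"
    using h d unfolding little_lipschitz_space_iff by meson
  obtain n1 :: nat where n1: "C / d \<le> n1" using real_arch_simple by blast
  define n where "n = Suc (max n0 n1)"
  have n: "n > 0" "n \<ge> n0" "C \<le> d * n"
  proof -
    have "C / d \<le> n" using n1 by (simp add: n_def)
    then show "C \<le> d * n" using d by (simp add: field_simps)
  qed (auto simp: n_def)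
  define \<tau> :: "nat \<Rightarrow> real" where "\<tau> k = max 0 (min 1 (2 - k / n))" for k
  have tau_range: "0 \<le> \<tau> k" "\<tau> k \<le> 1" for k by (auto simp: \<tau>_def)
  have tau_1: "\<tau> k = 1" if "k \<le> n" for k using that n by (simp add: \<tau>_def)
  have tau_0: "\<tau> k = 0" if "k \<ge> 2 * n" for k
  proof -
    have "real k \<ge> 2 * real n" using that by linarith
    then have "real k / n \<ge> 2" using n by (simp add: pos_le_divide_eq)
    then show ?thesis by (simp add: \<tau>_def)
  qed
  have tau_step: "\<bar>\<tau> k - \<tau> (Suc k)\<bar> \<le> 1 / n" for k
  proof -
    have "real (Suc k) / n = k / n + 1 / n" by (simp add: add_divide_distrib)
    moreover have "1 / real n \<ge> 0" by simp
    ultimately show ?thesis unfolding \<tau>_def by linarith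
  qed
  define g where "g v = h v * \<tau> (level v)" for v
  have "{v. g v \<noteq> 0} \<subseteq> {v. level v \<le> 2 * n}"
  proof
    fix v assume "v \<in> {v. g v \<noteq> 0}"
    then show "v \<in> {v. level v \<le> 2 * n}"
      using tau_0[of "level v"] by (force simp: g_def)
  qed
  then have "finite {v. g v \<noteq> 0}" using finite_level_le finite_subset by blast
  moreover have "lnorm (\<lambda>v. h v - g v) \<le> 4 * d"
  proof (rule lnorm_le)
    show "cmod (h r - g r) \<le> 4 * d"
      using d by (simp add: g_def level_root tau_1)
  next
    fix v assume v: "v \<noteq> r"
    let ?k = "level (par v)"
    have k: "level v = Suc ?k" using level_parent v by simp
    \<comment> \<open>Discrete product rule: one term carries the increment of \<open>h\<close>, the
      other that of the cutoff \<open>\<tau>\<close>.\<close>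
    have "h v - g v - (h (par v) - g (par v)) =
        (h v - h (par v)) * of_real (1 - \<tau> (Suc ?k)) + h (par v) * of_real (\<tau> ?k - \<tau> (Suc ?k))"
      by (simp add: g_def k algebra_simps)
    also have "cmod \<dots> \<le> cmod (h v - h (par v)) * \<bar>1 - \<tau> (Suc ?k)\<bar>
        + cmod (h (par v)) * \<bar>\<tau> ?k - \<tau> (Suc ?k)\<bar>"
      by (rule order_trans[OF norm_triangle_ineq]) (simp only: norm_mult norm_of_real order_refl)
    \<comment> \<open>The first term lives only above level \<open>n\<close>, where increments of
      \<open>h\<close> are below \<open>d\<close>. In the second, a parent below level
      \<open>2 * n\<close> has a value of size at most \<open>C + 2 * d * n \<le> 3 * d * n\<close>,
      while \<open>\<tau>\<close> changes by at most \<open>1 / n\<close>; from level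
      \<open>2 * n\<close> on, \<open>\<tau>\<close> is constantly zero.\<close>
    also have "\<dots> \<le> d + 3 * d"
    proof (rule add_mono)
      show "cmod (h v - h (par v)) * \<bar>1 - \<tau> (Suc ?k)\<bar> \<le> d"
      proof (cases "Suc ?k \<le> n")
        case True
        then show ?thesis using tau_1 d by simp
      next
        case False
        then have "cmod (h v - h (par v)) < d" using n0 n k by simp
        moreover have "\<bar>1 - \<tau> (Suc ?k)\<bar> \<le> 1" using tau_range[of "Suc ?k"] by linarith
        ultimately show ?thesis
          using mult_mono[of "cmod (h v - h (par v))" d "\<bar>1 - \<tau> (Suc ?k)\<bar>" 1] d by simp
      qed
      show "cmod (h (par v)) * \<bar>\<tau> ?k - \<tau> (Suc ?k)\<bar> \<le> 3 * d"
      proof (cases "?k \<ge> 2 * n")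
        case True
        then show ?thesis using tau_0 d by simp
      next
        case False
        then have "real ?k \<le> 2 * n" by linarith
        then have "d * ?k \<le> d * (2 * n)" using d by (intro mult_left_mono) auto
        then have "cmod (h (par v)) \<le> 3 * d * n"
          using C(2)[of "par v"] n(3) by (simp add: algebra_simps)
        then have "cmod (h (par v)) * \<bar>\<tau> ?k - \<tau> (Suc ?k)\<bar> \<le> 3 * d * n * (1 / n)"
          using tau_step[of ?k] d by (intro mult_mono) auto
        then show ?thesis using n by simp
      qed
    qed
    finally show "cmod (h v - g v - (h (par v) - g (par v))) \<le> 4 * d" by simp
  qed
  moreover have "4 * d < e" using e by (simp add: d_def)
  ultimately show thesis using that by force
qed

end


section \<open>Pasting a universal function\<close>

text \<open>Association lists with values in a countable dense set of complex numbers code countably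
  many functions. Values are approximated one by one on the finite support of \<open>g\<close>;
  elsewhere both functions are zero.\<close>

lemma finite_support_countable_dense:
  assumes "countable (UNIV :: 'a set)"
  obtains y :: "nat \<Rightarrow> 'a \<Rightarrow> complex"
  where "\<And>j. finite {v. y j v \<noteq> 0}"
    and "\<And>g e. finite {v. g v \<noteq> 0} \<Longrightarrow> e > 0 \<Longrightarrow> \<exists>j. \<forall>v. cmod (g v - y j v) < e"
proof -
  obtain Q :: "complex set" where Q: "countable Q" "\<And>X. open X \<Longrightarrow> X \<noteq> {} \<Longrightarrow> \<exists>q\<in>Q. q \<in> X"
    by (metis countable_dense_setE)
  define F :: "('a \<times> complex) list \<Rightarrow> 'a \<Rightarrow> complex"
    where "F l v = (case map_of l v of None \<Rightarrow> 0 | Some q \<Rightarrow> q)" for l v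
  let ?Y = "F ` lists (UNIV \<times> Q)"
  have Y: "countable ?Y" "?Y \<noteq> {}"
    using assms Q(1) by (auto intro!: countable_image countable_lists countable_SIGMA)
  define y where "y = from_nat_into ?Y"
  have "finite {v. y j v \<noteq> 0}" for j
  proof -
    obtain l where "y j = F l"
      using from_nat_into[OF Y(2), of j] by (auto simp: y_def)
    then have "{v. y j v \<noteq> 0} \<subseteq> dom (map_of l)"
      by (auto simp: F_def split: option.splits)
    then show ?thesis using finite_dom_map_of finite_subset by blast
  qed
  moreover have "\<exists>j. \<forall>v. cmod (g v - y j v) < e" if g: "finite {v. g v \<noteq> 0}" and e: "e > 0" for g e
  proof -
    have "\<exists>q\<in>Q. q \<in> ball (g v) e" for v
      using e by (intro Q(2)) auto
    then obtain q where q: "\<And>v. q v \<in> Q" "\<And>v. cmod (g v - q v) < e"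
      by (metis dist_norm mem_ball)
    obtain vs where vs: "set vs = {v. g v \<noteq> 0}" using finite_list[OF g] by blast
    define l where "l = map (\<lambda>v. (v, q v)) vs"
    have "cmod (g v - F l v) < e" for v
      using q(2)[of v] e vs by (auto simp: F_def l_def map_of_map_restrict restrict_map_def)
    moreover have "l \<in> lists (UNIV \<times> Q)" using q(1) by (auto simp: l_def)
    then have "F l \<in> ?Y" by (rule imageI)
    then have "\<exists>j. y j = F l"
      unfolding y_def using Y(1) from_nat_into_surj by metis
    ultimately show ?thesis by metis
  qed
  ultimately show thesis using that by blast
qed

text \<open>Only finitely many exponents lead from \<open>F\<close> to \<open>F\<close>. For a
  suitable large \<open>n k\<close>, points of \<open>F\<close> have therefore left
  \<open>F\<close>, and points outside stay outside by hypothesis.\<close>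

lemma eventually_range_funpow_avoids:
  assumes no_periodic: "\<not> (\<exists>v. \<exists>p::nat. p \<ge> 1 \<and> (\<phi> ^^ p) v = v)"
    and n: "strict_mono (n :: nat \<Rightarrow> nat)"
    and N: "\<exists>N. \<forall>k\<ge>N. (\<phi> ^^ n k) ` (- F) \<subseteq> - F"
    and F: "finite F"
  obtains m where "\<And>i v. i \<ge> m \<Longrightarrow> (\<phi> ^^ i) v \<notin> F"
proof -
  have "finite {i. (\<phi> ^^ i) v = w}" for v w
  proof -
    \<comment> \<open>Hitting \<open>w\<close> at two different times would make \<open>w\<close>
      periodic.\<close>
    have "i = j" if "(\<phi> ^^ i) v = w" "(\<phi> ^^ j) v = w" "i \<le> j" for i j
    proof (rule ccontr)
      assume "i \<noteq> j"
      moreover have "(\<phi> ^^ (j - i)) w = w"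
        using that by (metis comp_apply funpow_add le_add_diff_inverse2)
      ultimately show False
        using no_periodic that(3) by (metis diff_is_0_eq le_antisym less_one linorder_not_le)
    qed
    then have "\<exists>i. {i. (\<phi> ^^ i) v = w} \<subseteq> {i}"
      by (metis (mono_tags, lifting) linear mem_Collect_eq singleton_iff subsetI)
    then show ?thesis using finite_subset by blast
  qed
  then have "finite (\<Union>v\<in>F. \<Union>w\<in>F. {i. (\<phi> ^^ i) v = w})"
    using F by blast
  then obtain m where m: "\<And>i v w. v \<in> F \<Longrightarrow> w \<in> F \<Longrightarrow> (\<phi> ^^ i) v = w \<Longrightarrow> i < m"
    unfolding finite_nat_set_iff_bounded by auto
  obtain N where N: "\<And>k. k \<ge> N \<Longrightarrow> (\<phi> ^^ n k) ` (- F) \<subseteq> - F" using N by blast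
  define k where "k = max N m"
  have "n k \<ge> m"
    using strict_mono_imp_increasing[OF n, of k] by (simp add: k_def)
  then have k: "(\<phi> ^^ n k) v \<notin> F" for v
    using m[of v "(\<phi> ^^ n k) v" "n k"] N[of k] by (cases "v \<in> F") (auto simp: k_def)
  \<comment> \<open>Ranges of iterates decrease: \<open>\<phi> ^^ i\<close> takes its values in the
    range of \<open>\<phi> ^^ n k\<close>.\<close>
  have "(\<phi> ^^ i) v \<notin> F" if "i \<ge> n k" for i v
    using k[of "(\<phi> ^^ (i - n k)) v"] that by (metis comp_apply funpow_add le_add_diff_inverse)
  then show thesis using that by blast
qed

text \<open>\<open>f\<close> is the sum over \<open>j\<close> of \<open>y j\<close> transported by
  \<open>\<phi> ^^ n j\<close> and divided by \<open>c ^ n j\<close>. Under the power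
  \<open>n i\<close>, terms with \<open>j < i\<close> vanish, the term \<open>j = i\<close> returns
  \<open>y i\<close> exactly, and terms with \<open>j > i\<close> remain small.\<close>

lemma universal_function:
  fixes y :: "nat \<Rightarrow> 'a \<Rightarrow> complex"
  assumes inj: "inj (\<phi> :: 'a \<Rightarrow> 'a)" and c: "cmod c > 1"
    and avoid: "\<And>F. finite F \<Longrightarrow> \<exists>m. \<forall>i\<ge>m. \<forall>v. (\<phi> ^^ i) v \<notin> F"
    and fin: "\<And>j. finite {v. y j v \<noteq> 0}"
  shows "\<exists>f n. (\<forall>j v. cmod (c ^ n j * f ((\<phi> ^^ n j) v) - y j v) \<le> 1 / Suc j) \<and>
    (\<forall>e>0. finite {v. cmod (f v) \<ge> e})"
proof -
  define F where "F j = {v. y j v \<noteq> 0}" for j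
  obtain M where M: "\<And>j i v. i \<ge> M j \<Longrightarrow> (\<phi> ^^ i) v \<notin> F j"
    using avoid[OF fin] unfolding F_def by metis
  have "\<exists>k. \<forall>v. cmod (y j v) * Suc j \<le> cmod c ^ k" for j
  proof -
    obtain k where k: "(\<Sum>v\<in>F j. cmod (y j v)) * Suc j < cmod c ^ k"
      using real_arch_pow[OF c] by blast
    have "cmod (y j v) * Suc j \<le> cmod c ^ k" for v
    proof -
      have "cmod (y j v) \<le> (\<Sum>v\<in>F j. cmod (y j v))"
        by (cases "v \<in> F j") (auto simp: F_def sum_nonneg intro: member_le_sum fin)
      then have "cmod (y j v) * Suc j \<le> (\<Sum>v\<in>F j. cmod (y j v)) * Suc j"
        by (rule mult_right_mono) simp
      then show ?thesis using k by linarith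
    qed
    then show ?thesis by blast
  qed
  then obtain K where K: "\<And>j v. cmod (y j v) * Suc j \<le> cmod c ^ K j" by metis
  \<comment> \<open>The summand \<open>M j\<close> pushes later ranges off the support of
    \<open>y j\<close>; \<open>K (Suc j)\<close> leaves enough powers of \<open>c\<close> to shrink
    the next term after \<open>n j\<close> of them are used up. Starting at \<open>K 0\<close> gives
    \<open>K j \<le> n j\<close> also for \<open>j = 0\<close>.\<close>
  define n where "n = rec_nat (K 0) (\<lambda>j nj. nj + M j + K (Suc j))"
  have n_Suc: "n (Suc j) = n j + M j + K (Suc j)" and n_0: "n 0 = K 0" for j
    by (simp_all add: n_def)
  have gap: "n j \<ge> n i + M i + K j" if "i < j" for i j
    using that
  proof (induction j)
    case (Suc j)
    then show ?case using n_Suc[of j] by (cases "i = j") auto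
  qed simp
  have K_le: "K j \<le> n j" for j by (cases j) (auto simp: n_Suc n_0)
  have bound: "cmod (y j v) / cmod c ^ k \<le> 1 / Suc j" if "k \<ge> K j" for j k v
  proof -
    have "cmod (y j v) * Suc j \<le> cmod c ^ k"
      using K[of j v] power_increasing[OF that, of "cmod c"] c by linarith
    moreover have "cmod c ^ k > 0" using c by (intro zero_less_power) linarith
    ultimately show ?thesis by (simp add: pos_divide_le_eq pos_le_divide_eq)
  qed
  have inj_pow: "inj (\<phi> ^^ k)" for k using inj by (rule inj_fn)
  define I where "I = Sigma UNIV F"
  define pos where "pos = (\<lambda>(j, u). (\<phi> ^^ n j) u)"
  \<comment> \<open>Here \<open>v\<close> is arbitrary: the support of term \<open>i\<close> misses
    the whole range of \<open>\<phi> ^^ n j\<close>. This gives disjoint supports and also kills the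
    earlier terms under later powers.\<close>
  have disjoint: False
    if "u \<in> F i" "i < j" "(\<phi> ^^ n i) u = (\<phi> ^^ n j) v" for i j u v
  proof -
    have "(\<phi> ^^ n i) u = (\<phi> ^^ n i) ((\<phi> ^^ (n j - n i)) v)"
      using gap[OF that(2)] that(3) by (metis add_leD1 comp_apply funpow_add le_add_diff_inverse)
    then have "u = (\<phi> ^^ (n j - n i)) v" using inj_pow by (simp add: inj_eq)
    moreover have "n j - n i \<ge> M i" using gap[OF that(2)] by linarith
    ultimately show False using M that(1) by blast
  qed
  have inj_pos: "inj_on pos I"
  proof (rule inj_onI, clarsimp simp: I_def pos_def)
    fix i j u v assume *: "u \<in> F i" "v \<in> F j" "(\<phi> ^^ n i) u = (\<phi> ^^ n j) v"
    then have "i = j" using disjoint by (metis linorder_neqE_nat)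
    then show "i = j \<and> u = v" using * inj_pow by (simp add: inj_eq)
  qed
  \<comment> \<open>\<open>pos (j, u)\<close> is the vertex where the scaled value
    \<open>y j u\<close> is placed; injectivity of \<open>pos\<close> makes the pasted value
    unambiguous.\<close>
  define f where "f w = (if w \<in> pos ` I
      then case inv_into I pos w of (j, u) \<Rightarrow> y j u / c ^ n j else 0)" for w
  have f_pos: "f ((\<phi> ^^ n j) u) = y j u / c ^ n j" if "u \<in> F j" for j u
  proof -
    have "(j, u) \<in> I" using that by (simp add: I_def)
    then have "f (pos (j, u)) = y j u / c ^ n j"
      using inv_into_f_f[OF inj_pos] by (simp add: f_def)
    then show ?thesis by (simp add: pos_def)
  qed
  have f_cases: "f w = 0 \<or> (\<exists>j u. u \<in> F j \<and> w = (\<phi> ^^ n j) u)" for w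
    by (auto simp: f_def I_def pos_def)
  have "cmod (c ^ n i * f ((\<phi> ^^ n i) v) - y i v) \<le> 1 / Suc i" for i v
  proof (cases "v \<in> F i")
    case True
    have "c \<noteq> 0" using c by auto
    then show ?thesis using True by (simp add: f_pos)
  next
    case False
    then have y0: "y i v = 0" by (simp add: F_def)
    show ?thesis
    proof (cases "f ((\<phi> ^^ n i) v) = 0")
      case True
      then show ?thesis using y0 by simp
    next
      case nz: False
      then obtain j u where ju: "u \<in> F j" "(\<phi> ^^ n i) v = (\<phi> ^^ n j) u"
        using f_cases by blast
      have "j \<noteq> i" using ju False inj_pow by (metis inj_eq)
      moreover have "\<not> j < i" using disjoint ju by metis
      ultimately have ij: "i < j" by simp
      have "c ^ n i * f ((\<phi> ^^ n i) v) = y j u / c ^ (n j - n i)"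
      proof -
        have "c ^ n j = c ^ n i * c ^ (n j - n i)"
          using gap[OF ij] by (simp flip: power_add)
        moreover have "c \<noteq> 0" using c by auto
        ultimately show ?thesis using f_pos[OF ju(1)] ju(2) by simp
      qed
      then have "cmod (c ^ n i * f ((\<phi> ^^ n i) v)) = cmod (y j u) / cmod c ^ (n j - n i)"
        by (simp add: norm_divide norm_power)
      also have "\<dots> \<le> 1 / Suc j"
        using gap[OF ij] by (intro bound) linarith
      also have "\<dots> \<le> 1 / Suc i"
        using ij by (simp add: frac_le)
      finally show ?thesis using y0 by simp
    qed
  qed
  moreover have "finite {w. cmod (f w) \<ge> e}" if e: "e > 0" for e
  proof -
    obtain J where J: "1 / Suc J < e" using nat_approx_posE[OF e] by blast
    \<comment> \<open>Values in the block of \<open>j\<close> are at most \<open>1 / Suc j\<close>,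
      so only finitely many finite blocks reach \<open>e\<close>.\<close>
    have "{w. cmod (f w) \<ge> e} \<subseteq> (\<Union>j\<le>J. (\<phi> ^^ n j) ` F j)"
    proof
      fix w assume "w \<in> {w. cmod (f w) \<ge> e}"
      then have w: "cmod (f w) \<ge> e" by simp
      then obtain j u where ju: "u \<in> F j" "w = (\<phi> ^^ n j) u"
        using f_cases[of w] e by auto
      have "cmod (f w) \<le> 1 / Suc j"
        using f_pos[OF ju(1)] ju(2) bound[OF K_le, of j u] by (simp add: norm_divide norm_power)
      then have "1 / Suc J < 1 / real (Suc j)" using w J by linarith
      then have "j \<le> J" by (simp add: field_simps)
      then show "w \<in> (\<Union>j\<le>J. (\<phi> ^^ n j) ` F j)" using ju by blast
    qed
    moreover have "finite (\<Union>j\<le>J. (\<phi> ^^ n j) ` F j)" using fin by (auto simp: F_def)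
    ultimately show ?thesis using finite_subset by blast
  qed
  ultimately show ?thesis by blast
qed


section \<open>Hypercyclicity\<close>

lemma bounded_operator_on_funpow:
  assumes "bounded_operator_on X N A" "f \<in> X"
  shows "(A ^^ n) f \<in> X"
  using assms by (induction n) (auto simp: bounded_operator_on_def)

lemma funpow_scaled_composition:
  "((\<lambda>f v. c * composition_operator \<phi> f v) ^^ n) f = (\<lambda>v. c ^ n * f ((\<phi> ^^ n) v))"
  by (induction n) (auto simp: composition_operator_def funpow_swap1)

context rooted_tree
begin

lemma bounded_operator_on_scaled:
  assumes "bounded_operator_on \<L>\<^sub>0 lnorm A"
  shows "bounded_operator_on \<L>\<^sub>0 lnorm (\<lambda>f v. c * A f v)"
proof -
  obtain K where K: "\<And>f. f \<in> \<L>\<^sub>0 \<Longrightarrow> lnorm (A f) \<le> K * lnorm f"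
    using assms unfolding bounded_operator_on_def by blast
  have A: "A f \<in> \<L>\<^sub>0" if "f \<in> \<L>\<^sub>0" for f
    using assms that unfolding bounded_operator_on_def by blast
  have "lnorm (\<lambda>v. c * A f v) \<le> (cmod c * K) * lnorm f" if "f \<in> \<L>\<^sub>0" for f
    using lnorm_scale_le[OF little_subset[OF A[OF that]], of c]
      mult_left_mono[OF K[OF that], of "cmod c"] by (simp add: mult.assoc)
  then have "\<exists>K. \<forall>f\<in>\<L>\<^sub>0. lnorm (\<lambda>v. c * A f v) \<le> K * lnorm f" by blast
  then show ?thesis
    using assms little_lipschitz_space_scale
    by (simp add: bounded_operator_on_def algebra_simps)
qed

lemma hypercyclic_on_little:
  assumes bounded: "bounded_operator_on \<L>\<^sub>0 lnorm A"
    and f: "f \<in> \<L>\<^sub>0"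
    and dense: "\<And>h e. h \<in> \<L>\<^sub>0 \<Longrightarrow> e > 0 \<Longrightarrow> \<exists>n. lnorm (\<lambda>v. h v - (A ^^ n) f v) < e"
  shows "hypercyclic_on \<L>\<^sub>0 lnorm A"
proof -
  interpret Metric_space "\<L>\<^sub>0" "\<lambda>f g. lnorm (\<lambda>v. f v - g v)"
    by (rule Metric_space_little)
  have orbit: "(A ^^ n) f \<in> \<L>\<^sub>0" for n
    using bounded f by (rule bounded_operator_on_funpow)
  have "mtopology closure_of {(A ^^ n) f | n. True} = \<L>\<^sub>0"
    unfolding metric_closure_of using dense orbit by (fastforce simp: in_mball)
  then show ?thesis
    unfolding hypercyclic_on_def using bounded f by blast
qed

end

theorem theorem6p1:
  fixes E :: "'a \<Rightarrow> 'a \<Rightarrow> bool" and r :: 'a and \<phi> :: "'a \<Rightarrow> 'a"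
  assumes tree: "rooted_tree E r"
    and inj: "inj \<phi>"
    and no_periodic: "\<not> (\<exists>v. \<exists>p::nat. p \<ge> 1 \<and> (\<phi> ^^ p) v = v)"
    and bounded: "bounded_operator_on (little_lipschitz_space E r) (lipschitz_norm E r)
                    (composition_operator \<phi>)"
    and seq: "\<exists>n :: nat \<Rightarrow> nat. strict_mono n \<and>
                (\<forall>S :: 'a set. finite (UNIV - S) \<longrightarrow>
                   (\<exists>N. \<forall>k\<ge>N. (\<phi> ^^ n k) ` S \<subseteq> S))"
  shows "\<forall>c :: complex. cmod c > 1 \<longrightarrow>
           hypercyclic_on (little_lipschitz_space E r) (lipschitz_norm E r)
             (\<lambda>f v. c * composition_operator \<phi> f v)"
proof (intro allI impI)
  fix c :: complex assume c: "cmod c > 1"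
  interpret rooted_tree E r by (rule tree)
  have avoid: "\<exists>m. \<forall>i\<ge>m. \<forall>v. (\<phi> ^^ i) v \<notin> F" if F: "finite F" for F
  proof -
    obtain n :: "nat \<Rightarrow> nat" where n: "strict_mono n"
      and "\<And>S. finite (UNIV - S) \<Longrightarrow> \<exists>N. \<forall>k\<ge>N. (\<phi> ^^ n k) ` S \<subseteq> S"
      using seq by blast
    then have "\<exists>N. \<forall>k\<ge>N. (\<phi> ^^ n k) ` (- F) \<subseteq> - F"
      using F by (simp add: Compl_eq_Diff_UNIV[symmetric])
    then show ?thesis
      using eventually_range_funpow_avoids[OF no_periodic n _ F] by metis
  qed
  obtain y :: "nat \<Rightarrow> 'a \<Rightarrow> complex" where y: "\<And>j. finite {v. y j v \<noteq> 0}"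
    and y_dense: "\<And>g e. finite {v. g v \<noteq> 0} \<Longrightarrow> e > 0 \<Longrightarrow> \<exists>j. \<forall>v. cmod (g v - y j v) < e"
    using finite_support_countable_dense[OF countable_vertices] by blast
  \<comment> \<open>Each \<open>y j\<close> is listed infinitely often, so it is approximated with errors tending to zero.\<close>
  define z where "z i = y (fst (prod_decode i))" for i
  have z_fin: "finite {v. z i v \<noteq> 0}" for i
    by (simp add: z_def y)
  obtain f n where f: "\<And>i v. cmod (c ^ n i * f ((\<phi> ^^ n i) v) - z i v) \<le> 1 / Suc i"
    and f_fin: "\<And>e. e > 0 \<Longrightarrow> finite {v. cmod (f v) \<ge> e}"
    using universal_function[where y = z, OF inj c _ z_fin] avoid by metis
  let ?A = "\<lambda>f v. c * composition_operator \<phi> f v"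
  show "hypercyclic_on \<L>\<^sub>0 lnorm ?A"
  proof (rule hypercyclic_on_little)
    show A: "bounded_operator_on \<L>\<^sub>0 lnorm ?A"
      by (rule bounded_operator_on_scaled[OF bounded])
    show f_little: "f \<in> \<L>\<^sub>0" by (rule vanishing_imp_little[OF f_fin])
    fix h and e :: real assume h: "h \<in> \<L>\<^sub>0" and e: "e > 0"
    obtain g where g: "finite {v. g v \<noteq> 0}" "lnorm (\<lambda>v. h v - g v) < e / 2"
      using finite_support_dense[OF h] e by (metis half_gt_zero)
    \<comment> \<open>Two errors of \<open>e / 10\<close> in the supremum norm become at most
      \<open>2 * (e / 5)\<close> in the Lipschitz norm, less than the remaining
      \<open>e / 2\<close>.\<close>
    obtain j where j: "\<And>v. cmod (g v - y j v) < e / 10"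
      using y_dense[OF g(1), of "e / 10"] e by auto
    obtain k where k: "1 / Suc k < e / 10"
      using nat_approx_posE[of "e / 10"] e by auto
    \<comment> \<open>Then \<open>z i\<close> is \<open>y j\<close>, and \<open>i \<ge> k\<close>
      makes the error \<open>1 / Suc i\<close> small.\<close>
    define i where "i = prod_encode (j, k)"
    have "1 / real (Suc i) \<le> 1 / Suc k"
      using le_prod_encode_2[of k j] by (simp add: i_def frac_le)
    then have "cmod (g v - (?A ^^ n i) f v) \<le> e / 5" for v
      using f[of i v] j[of v] k norm_triangle_ineq4[of "g v - z i v" "(?A ^^ n i) f v - z i v"]
      unfolding funpow_scaled_composition by (simp add: i_def z_def)
    then have "lnorm (\<lambda>v. g v - (?A ^^ n i) f v) \<le> 2 * (e / 5)"
      by (rule lnorm_le_sup)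
    moreover have "(?A ^^ n i) f \<in> \<L>\<^sub>0"
      using A f_little by (rule bounded_operator_on_funpow)
    ultimately have "lnorm (\<lambda>v. h v - (?A ^^ n i) f v) < e"
      using lnorm_triangle[of h g "(?A ^^ n i) f"] h g finite_support_imp_little little_subset e
      by fastforce
    then show "\<exists>m. lnorm (\<lambda>v. h v - (?A ^^ m) f v) < e" by blast
  qed
qed

end
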